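(* Let $A_1,\dots,A_n,B$ be real symmetric matrices of the same order and $c\in\mathbb{R}^n$. Consider $$(SDP)\quad \min\Big\{\sum_{i=1}^n c_ix_i:\ \sum_{i=1}^n A_ix_i\succeq B,\ x\in\mathbb{R}^n\Big\}$$ and $$(DSDP)\quad \max\big\{B\cdot Y:\ A_i\cdot Y=c_i\ \forall i\in\{1,\dots,n\},\ Y\succeq 0\big\}.$$ If $(DSDP)$ is bounded and has a strictly feasible solution, then the optimal values of $(SDP)$ and $(DSDP)$ are equal and $(SDP)$ reaches this optimum value. If $(DSDP)$ is unbounded, then $(SDP)$ is infeasible.
   Context: $M\succeq N$ means that $M-N$ is symmetric positive semidefinite, $M\succ N$ that $M-N$ is symmetric positive definite; $M\cdot N=\sum_{i,j}M_{ij}N_{ij}$. The variable $Y$ is a real symmetric matrix. The optimal value of $(SDP)$ is the infimum of its objective over feasible points, that of $(DSDP)$ is the supremum (not necessarily attained). "Bounded" means the supremum of $(DSDP)$ is not $+\infty$, "unbounded" means it is $+\infty$. A strictly feasible solution of $(DSDP)$ is a $Y\succ 0$ with $A_i\cdot Y=c_i$ for all $i$. *)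

theory Defs
  imports "HOL-Analysis.Analysis"
begin

definition symmetric_matrix :: "real^'m^'m \<Rightarrow> bool" where
  "symmetric_matrix M \<longleftrightarrow> transpose M = M"

definition pos_semidefinite :: "real^'m^'m \<Rightarrow> bool" where
  "pos_semidefinite M \<longleftrightarrow> symmetric_matrix M \<and> (\<forall>v. 0 \<le> v \<bullet> (M *v v))"

definition pos_definite :: "real^'m^'m \<Rightarrow> bool" where
  "pos_definite M \<longleftrightarrow> symmetric_matrix M \<and> (\<forall>v. v \<noteq> 0 \<longrightarrow> 0 < v \<bullet> (M *v v))"

definition loewner_ge :: "real^'m^'m \<Rightarrow> real^'m^'m \<Rightarrow> bool"  (infix "\<succeq>" 50) where
  "M \<succeq> N \<longleftrightarrow> pos_semidefinite (M - N)"

definition loewner_gt :: "real^'m^'m \<Rightarrow> real^'m^'m \<Rightarrow> bool"  (infix "\<succ>" 50) where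
  "M \<succ> N \<longleftrightarrow> pos_definite (M - N)"

text \<open>The matrix product written \<open>M \<cdot> N\<close> on paper is the inner product that the library puts on
  nested vectors:\<close>

lemma matrix_inner_eq_sum:
  fixes M N :: "real^'m^'m"
  shows "M \<bullet> N = (\<Sum>i\<in>UNIV. \<Sum>j\<in>UNIV. M $ i $ j * N $ i $ j)"
  by (simp add: inner_vec_def)

definition sdp_feasible :: "('n::finite \<Rightarrow> real^'m^'m) \<Rightarrow> real^'m^'m \<Rightarrow> (real^'n) set" where
  "sdp_feasible A B = {x. (\<Sum>i\<in>UNIV. (x $ i) *\<^sub>R A i) \<succeq> B}"

definition sdp_objective :: "real^'n \<Rightarrow> real^'n \<Rightarrow> real" where
  "sdp_objective c x = (\<Sum>i\<in>UNIV. c $ i * x $ i)"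

text \<open>Optimal values are extended reals: an infeasible minimization problem has value \<open>\<infinity>\<close>,
  an infeasible maximization problem has value \<open>-\<infinity>\<close>.\<close>

definition sdp_value :: "('n::finite \<Rightarrow> real^'m^'m) \<Rightarrow> real^'m^'m \<Rightarrow> real^'n \<Rightarrow> ereal" where
  "sdp_value A B c = (INF x\<in>sdp_feasible A B. ereal (sdp_objective c x))"

definition sdp_attained :: "('n::finite \<Rightarrow> real^'m^'m) \<Rightarrow> real^'m^'m \<Rightarrow> real^'n \<Rightarrow> bool" where
  "sdp_attained A B c \<longleftrightarrow>
     (\<exists>x\<in>sdp_feasible A B. ereal (sdp_objective c x) = sdp_value A B c)"

definition dsdp_feasible :: "('n::finite \<Rightarrow> real^'m^'m) \<Rightarrow> real^'n \<Rightarrow> (real^'m^'m) set" where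
  "dsdp_feasible A c = {Y. (\<forall>i. A i \<bullet> Y = c $ i) \<and> Y \<succeq> 0}"

definition dsdp_strictly_feasible :: "('n::finite \<Rightarrow> real^'m^'m) \<Rightarrow> real^'n \<Rightarrow> (real^'m^'m) set" where
  "dsdp_strictly_feasible A c = {Y. (\<forall>i. A i \<bullet> Y = c $ i) \<and> Y \<succ> 0}"

definition dsdp_value :: "('n::finite \<Rightarrow> real^'m^'m) \<Rightarrow> real^'m^'m \<Rightarrow> real^'n \<Rightarrow> ereal" where
  "dsdp_value A B c = (SUP Y\<in>dsdp_feasible A c. ereal (B \<bullet> Y))"

definition dsdp_bounded :: "('n::finite \<Rightarrow> real^'m^'m) \<Rightarrow> real^'m^'m \<Rightarrow> real^'n \<Rightarrow> bool" where
  "dsdp_bounded A B c \<longleftrightarrow> dsdp_value A B c \<noteq> \<infinity>"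

definition dsdp_unbounded :: "('n::finite \<Rightarrow> real^'m^'m) \<Rightarrow> real^'m^'m \<Rightarrow> real^'n \<Rightarrow> bool" where
  "dsdp_unbounded A B c \<longleftrightarrow> dsdp_value A B c = \<infinity>"

end

theory Submission
  imports Defs
begin

text \<open>Weak duality is self-duality of the cone of positive semidefinite matrices, which follows by
  splitting off rank-one matrices through Schur complements. For strong duality with finite dual
  value \<open>d\<close>, the convex set of all \<open>(\<A>(Y) - c, t)\<close> with \<open>Y \<succeq> 0\<close> and \<open>t < B \<bullet> Y - d\<close> misses the origin,
  where \<open>\<A>(Y)\<close> is the vector of the \<open>A i \<bullet> Y\<close>. A separating functional, chosen in the span of this
  set so that dependent \<open>A i\<close> do no harm, cannot be vertical because \<open>Y\<close> may be perturbed in every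
  direction around a strictly feasible point; normalized, it is an optimal primal solution.\<close>

section \<open>Rank-one matrices and closure properties of the semidefinite cone\<close>

definition outer_product :: "real^'m \<Rightarrow> real^'m \<Rightarrow> real^'m^'m" where
  "outer_product u v = (\<chi> i j. u $ i * v $ j)"

lemma outer_product_mult_vec: "outer_product u v *v w = (v \<bullet> w) *\<^sub>R u"
  by (simp add: vec_eq_iff outer_product_def matrix_vector_mult_def inner_vec_def
      sum_distrib_left mult_ac)

lemma inner_outer_product: "M \<bullet> outer_product u v = u \<bullet> (M *v v)"
  by (simp add: inner_vec_def outer_product_def matrix_vector_mult_def sum_distrib_left mult_ac)

lemma pos_semidefinite_outer_product: "pos_semidefinite (outer_product v v)"
proof -
  have "symmetric_matrix (outer_product v v)"
    by (simp add: symmetric_matrix_def outer_product_def transpose_def vec_eq_iff mult.commute)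
  then show ?thesis
    by (simp add: pos_semidefinite_def outer_product_mult_vec inner_commute[of v])
qed

lemma symmetric_matrix_nth: "symmetric_matrix M \<Longrightarrow> M $ i $ j = M $ j $ i"
  unfolding symmetric_matrix_def transpose_def by (metis vec_lambda_beta)

lemma symmetric_matrix_add:
  "symmetric_matrix M \<Longrightarrow> symmetric_matrix N \<Longrightarrow> symmetric_matrix (M + N)"
  by (simp add: symmetric_matrix_def transpose_def vec_eq_iff)

lemma symmetric_matrix_diff:
  "symmetric_matrix M \<Longrightarrow> symmetric_matrix N \<Longrightarrow> symmetric_matrix (M - N)"
  by (simp add: symmetric_matrix_def transpose_def vec_eq_iff)

lemma symmetric_matrix_scaleR: "symmetric_matrix M \<Longrightarrow> symmetric_matrix (r *\<^sub>R M)"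
  by (simp add: symmetric_matrix_def transpose_def vec_eq_iff)

lemma symmetric_matrix_sum:
  "(\<And>i. i \<in> I \<Longrightarrow> symmetric_matrix (M i)) \<Longrightarrow> symmetric_matrix (sum M I)"
  by (induction I rule: infinite_finite_induct)
    (auto simp: symmetric_matrix_add, auto simp: symmetric_matrix_def transpose_def vec_eq_iff)

lemma pos_semidefinite_0: "pos_semidefinite 0"
  by (simp add: pos_semidefinite_def symmetric_matrix_def transpose_def vec_eq_iff)

lemma pos_semidefinite_add:
  "pos_semidefinite M \<Longrightarrow> pos_semidefinite N \<Longrightarrow> pos_semidefinite (M + N)"
  by (simp add: pos_semidefinite_def symmetric_matrix_add matrix_vector_mult_add_rdistrib
      inner_add_right)

lemma pos_semidefinite_scaleR:
  "pos_semidefinite M \<Longrightarrow> 0 \<le> r \<Longrightarrow> pos_semidefinite (r *\<^sub>R M)"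
  by (simp add: pos_semidefinite_def symmetric_matrix_scaleR scaleR_matrix_vector_assoc[symmetric])

lemma pos_definite_imp_pos_semidefinite: "pos_definite M \<Longrightarrow> pos_semidefinite M"
  unfolding pos_definite_def pos_semidefinite_def
  by (metis inner_zero_left less_imp_le order_refl)

section \<open>Schur complements and self-duality of the cone\<close>

text \<open>With a zero diagonal entry, the quadratic form on the line
  \<open>axis j 1 + s *\<^sub>R axis k 1\<close> is affine in \<open>s\<close> with slope
  \<open>2 * M $ k $ j\<close>; a nonzero slope would make it negative somewhere.\<close>

lemma pos_semidefinite_row_eq_0:
  fixes M :: "real^'m^'m"
  assumes M: "pos_semidefinite M" and 0: "M $ k $ k = 0"
  shows "M $ k = 0"
proof -
  have sym: "symmetric_matrix M" using M by (simp add: pos_semidefinite_def)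
  have "M $ k $ j = 0" for j
  proof (rule ccontr)
    assume nz: "M $ k $ j \<noteq> 0"
    \<comment> \<open>The value of \<open>s\<close> at which this affine function equals -1.\<close>
    define s where "s = - (M $ j $ j + 1) / (2 * M $ k $ j)"
    define v :: "real^'m" where "v = axis j 1 + s *\<^sub>R axis k 1"
    have "v \<bullet> (M *v v) = M $ j $ j + 2 * s * M $ k $ j"
      using 0 symmetric_matrix_nth[OF sym, of j k]
      by (simp add: v_def matrix_vector_right_distrib matrix_vector_mult_scaleR inner_add_left
          inner_add_right inner_axis' matrix_vector_mult_basis column_def)
    also have "\<dots> = -1" using nz by (simp add: s_def field_simps)
    finally show False using M by (metis pos_semidefinite_def neg_0_le_iff_le not_one_le_zero)
  qed
  then show ?thesis by (simp add: vec_eq_iff)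
qed

text \<open>The new form at \<open>v\<close> is the least value of the form of \<open>M\<close> on
  the line through \<open>v\<close> in direction \<open>axis k 1\<close>, hence nonnegative.\<close>

lemma pos_semidefinite_schur_complement:
  assumes M: "pos_semidefinite M" and pos: "0 < M $ k $ k"
  shows "pos_semidefinite (M - (1 / M $ k $ k) *\<^sub>R outer_product (M $ k) (M $ k))"
    (is "pos_semidefinite ?M")
proof -
  have sym: "symmetric_matrix M" using M by (simp add: pos_semidefinite_def)
  have "0 \<le> v \<bullet> (?M *v v)" for v
  proof -
    \<comment> \<open>The minimizer of the quadratic in \<open>t\<close> computed below for
      \<open>w \<bullet> (M *v w)\<close>.\<close>
    define t where "t = (M $ k \<bullet> v) / M $ k $ k"
    define w where "w = v - t *\<^sub>R axis k 1"
    have col: "M *v axis k 1 = M $ k"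
      using symmetric_matrix_nth[OF sym]
      by (simp add: matrix_vector_mult_basis column_def vec_eq_iff)
    have row: "(M *v v) $ k = M $ k \<bullet> v"
      by (simp add: matrix_vector_mult_def inner_vec_def)
    have "w \<bullet> (M *v w) = v \<bullet> (M *v v) - 2 * t * (M $ k \<bullet> v) + t\<^sup>2 * M $ k $ k"
      by (simp add: w_def matrix_vector_mult_diff_distrib matrix_vector_mult_scaleR col
          inner_diff_left inner_diff_right inner_axis' row inner_commute power2_eq_square
          algebra_simps)
    also have "\<dots> = v \<bullet> (?M *v v)"
      using pos by (simp add: t_def matrix_vector_mult_diff_rdistrib outer_product_mult_vec
          scaleR_matrix_vector_assoc[symmetric] inner_diff_right inner_commute power2_eq_square
          field_simps)
    finally show ?thesis using M by (metis pos_semidefinite_def)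
  qed
  then show ?thesis
    using sym pos_semidefinite_outer_product[of "M $ k"] unfolding pos_semidefinite_def
    by (metis symmetric_matrix_diff symmetric_matrix_scaleR)
qed

text \<open>Induction on the number of nonzero rows of \<open>M\<close>: passing to a Schur
  complement clears one row and revives none, and the rank-one matrix split off contributes a
  nonnegative multiple of a value of the form of \<open>Y\<close>.\<close>

lemma pos_semidefinite_inner_nonneg:
  assumes "pos_semidefinite M" and Y: "pos_semidefinite Y"
  shows "0 \<le> M \<bullet> Y"
  using assms(1)
proof (induction "card {k. M $ k \<noteq> 0}" arbitrary: M rule: less_induct)
  case less
  show ?case
  proof (cases "M = 0")
    case False
    then obtain k where k: "M $ k \<noteq> 0" by (metis vec_eq_iff zero_index)
    have "0 \<le> axis k 1 \<bullet> (M *v axis k 1)"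
      using less.prems by (simp add: pos_semidefinite_def)
    then have pos: "0 < M $ k $ k"
      using k pos_semidefinite_row_eq_0[OF less.prems]
      by (fastforce simp: inner_axis' matrix_vector_mult_basis column_def less_le)
    define N where "N = M - (1 / M $ k $ k) *\<^sub>R outer_product (M $ k) (M $ k)"
    have N: "pos_semidefinite N"
      unfolding N_def using less.prems pos by (rule pos_semidefinite_schur_complement)
    \<comment> \<open>Row \<open>i\<close> of the subtracted matrix is a multiple of
      \<open>M $ k $ i\<close>, which equals \<open>M $ i $ k = 0\<close> by symmetry.\<close>
    have "N $ i = 0" if "M $ i = 0" for i
      using that symmetric_matrix_nth[of M k i] less.prems
      by (simp add: N_def outer_product_def vec_eq_iff pos_semidefinite_def)
    moreover have "N $ k = 0"
      using pos by (simp add: N_def outer_product_def vec_eq_iff)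
    ultimately have "{i. N $ i \<noteq> 0} \<subset> {i. M $ i \<noteq> 0}"
      using k by blast
    then have "0 \<le> N \<bullet> Y"
      by (intro less.hyps psubset_card_mono N) auto
    moreover have "0 \<le> outer_product (M $ k) (M $ k) \<bullet> Y"
      using Y by (simp add: inner_commute[of "outer_product _ _"] inner_outer_product
          pos_semidefinite_def)
    moreover have "M \<bullet> Y = N \<bullet> Y + (1 / M $ k $ k) * (outer_product (M $ k) (M $ k) \<bullet> Y)"
      by (simp add: N_def inner_diff_left)
    ultimately show ?thesis using pos by simp
  qed simp
qed

text \<open>On the compact unit sphere the form of \<open>Y\<close> has a positive minimum
  \<open>a\<close> and that of \<open>W\<close> is at most some \<open>b > 0\<close>, so
  \<open>e = a / b\<close> works there; homogeneity extends this to all vectors.\<close>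

lemma pos_definite_perturb:
  fixes Y W :: "real^'m^'m"
  assumes Y: "pos_definite Y" and W: "symmetric_matrix W"
  obtains e where "0 < e" "pos_semidefinite (Y - e *\<^sub>R W)"
proof -
  let ?S = "sphere (0::real^'m) 1"
  have cont: "continuous_on ?S (\<lambda>v. v \<bullet> (M *v v))" for M :: "real^'m^'m"
    by (intro continuous_intros matrix_vector_mult_linear_continuous_on)
  have ne: "?S \<noteq> {}" by simp
  obtain p where p: "p \<in> ?S" "\<And>v. v \<in> ?S \<Longrightarrow> p \<bullet> (Y *v p) \<le> v \<bullet> (Y *v v)"
    using continuous_attains_inf[OF compact_sphere ne cont] by blast
  obtain q where q: "q \<in> ?S" "\<And>v. v \<in> ?S \<Longrightarrow> v \<bullet> (W *v v) \<le> q \<bullet> (W *v q)"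
    using continuous_attains_sup[OF compact_sphere ne cont] by blast
  define a where "a = p \<bullet> (Y *v p)"
  \<comment> \<open>The absolute value and the added 1 make \<open>b\<close> positive even if the
    maximum is not.\<close>
  define b where "b = \<bar>q \<bullet> (W *v q)\<bar> + 1"
  define e where "e = a / b"
  have "p \<noteq> 0" using p(1) by auto
  then have a: "0 < a" using Y by (simp add: a_def pos_definite_def)
  have b: "0 < b" by (simp add: b_def add_nonneg_pos)
  have e: "0 < e" using a b by (simp add: e_def)
  have unit: "0 \<le> v \<bullet> ((Y - e *\<^sub>R W) *v v)" if "v \<in> ?S" for v
  proof -
    have "v \<bullet> (W *v v) \<le> b" using q(2)[OF that] unfolding b_def by linarith
    then have "e * (v \<bullet> (W *v v)) \<le> e * b" using e by simp
    also have "\<dots> = a" using b by (simp add: e_def)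
    also have "\<dots> \<le> v \<bullet> (Y *v v)" using p(2)[OF that] by (simp add: a_def)
    finally show ?thesis
      by (simp add: matrix_vector_mult_diff_rdistrib scaleR_matrix_vector_assoc[symmetric]
          inner_diff_right)
  qed
  have "0 \<le> v \<bullet> ((Y - e *\<^sub>R W) *v v)" for v
  proof (cases "v = 0")
    case False
    define u where "u = v /\<^sub>R norm v"
    have "v = norm v *\<^sub>R u" using False by (simp add: u_def)
    then have "v \<bullet> ((Y - e *\<^sub>R W) *v v) = norm v * (norm v * (u \<bullet> ((Y - e *\<^sub>R W) *v u)))"
      by (metis inner_scaleR_left inner_scaleR_right matrix_vector_mult_scaleR)
    moreover have "u \<in> ?S" using False by (simp add: u_def)
    ultimately show ?thesis using unit by simp
  qed simp
  then have "pos_semidefinite (Y - e *\<^sub>R W)"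
    using Y W by (simp add: pos_semidefinite_def pos_definite_def symmetric_matrix_diff
        symmetric_matrix_scaleR)
  with e show ?thesis by (rule that)
qed

section \<open>Weak duality\<close>

lemma sdp_objective_eq_inner: "sdp_objective c x = x \<bullet> c"
  by (simp add: sdp_objective_def inner_vec_def mult.commute)

text \<open>The primal matrix map and the dual constraint map are adjoint to each other; both
  duality arguments rest on this.\<close>

lemma inner_matrix_combination:
  "(\<Sum>i\<in>UNIV. x $ i *\<^sub>R A i) \<bullet> Y = x \<bullet> (\<chi> i. A i \<bullet> Y)"
  by (simp add: inner_sum_left) (simp add: inner_vec_def[of x])

text \<open>The duality gap is the inner product of the primal slack matrix with \<open>Y\<close>,
  and both lie in the self-dual cone.\<close>

lemma sdp_weak_duality:
  assumes x: "x \<in> sdp_feasible A B" and Y: "Y \<in> dsdp_feasible A c"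
  shows "B \<bullet> Y \<le> sdp_objective c x"
proof -
  have "0 \<le> ((\<Sum>i\<in>UNIV. x $ i *\<^sub>R A i) - B) \<bullet> Y"
    using x Y by (intro pos_semidefinite_inner_nonneg)
      (auto simp: sdp_feasible_def dsdp_feasible_def loewner_ge_def)
  moreover have "(\<chi> i. A i \<bullet> Y) = c"
    using Y by (simp add: dsdp_feasible_def vec_eq_iff)
  ultimately show ?thesis
    by (simp add: inner_diff_left inner_matrix_combination sdp_objective_eq_inner)
qed

lemma dsdp_value_le_sdp_objective:
  "x \<in> sdp_feasible A B \<Longrightarrow> dsdp_value A B c \<le> ereal (sdp_objective c x)"
  unfolding dsdp_value_def by (rule SUP_least) (simp add: sdp_weak_duality)

section \<open>Strong duality by separation\<close>

text \<open>A negative value of the form at \<open>v\<close> would drive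
  \<open>M \<bullet> Y\<close> below any bound along the ray of multiples of
  \<open>outer_product v v\<close>.\<close>

lemma pos_semidefinite_if_inner_bounded_below:
  assumes sym: "symmetric_matrix M" and bd: "\<And>Y. pos_semidefinite Y \<Longrightarrow> r \<le> M \<bullet> Y"
  shows "pos_semidefinite M"
proof -
  have "0 \<le> v \<bullet> (M *v v)" for v
  proof (rule ccontr)
    assume neg: "\<not> 0 \<le> v \<bullet> (M *v v)"
    \<comment> \<open>Scaled so that the inner product becomes \<open>- \<bar>r\<bar> - 1\<close>,
      which is below \<open>r\<close>.\<close>
    define s where "s = (\<bar>r\<bar> + 1) / - (v \<bullet> (M *v v))"
    have "0 \<le> s" using neg by (simp add: s_def field_simps)
    then have "r \<le> M \<bullet> (s *\<^sub>R outer_product v v)"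
      by (intro bd pos_semidefinite_scaleR pos_semidefinite_outer_product)
    also have "\<dots> = - \<bar>r\<bar> - 1"
      using neg by (simp add: inner_outer_product s_def field_simps)
    finally show False by linarith
  qed
  with sym show ?thesis by (simp add: pos_semidefinite_def)
qed

text \<open>Taken with \<open>d\<close> the dual value, this yields a primal point that weak duality
  shows to be optimal.\<close>

lemma sdp_feasible_below_dual_bound:
  fixes A :: "'n::finite \<Rightarrow> real^'m^'m" and B :: "real^'m^'m" and c :: "real^'n"
  assumes A: "\<And>i. symmetric_matrix (A i)" and B: "symmetric_matrix B"
    and d: "\<And>Y. Y \<in> dsdp_feasible A c \<Longrightarrow> B \<bullet> Y \<le> d"
    and Y0: "Y0 \<in> dsdp_strictly_feasible A c"
  obtains x where "x \<in> sdp_feasible A B" "sdp_objective c x \<le> d"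
proof -
  define L where "L Y = (\<chi> i. A i \<bullet> Y)" for Y
  define X where "X x = (\<Sum>i\<in>UNIV. x $ i *\<^sub>R A i)" for x :: "real^'n"
  have X_inner: "X x \<bullet> Y = x \<bullet> L Y" for x Y
    by (simp add: X_def L_def inner_matrix_combination)
  have X_sym: "symmetric_matrix (X x)" for x
    by (auto simp: X_def intro!: symmetric_matrix_sum symmetric_matrix_scaleR A)
  have Y0_pd: "pos_definite Y0" and LY0: "L Y0 = c"
    using Y0 by (auto simp: dsdp_strictly_feasible_def loewner_gt_def L_def vec_eq_iff)
  \<comment> \<open>The strict inequality keeps the origin out of \<open>K\<close> even when some
    feasible \<open>Y\<close> attains \<open>d\<close>; letting \<open>t\<close> run down to minus
    infinity fixes the sign of \<open>s\<close> later.\<close>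
  define K where "K = {(L Y - c, t) |Y t. pos_semidefinite Y \<and> t < B \<bullet> Y - d}"
  have K_I: "(L Y - c, t) \<in> K" if "pos_semidefinite Y" "t < B \<bullet> Y - d" for Y t
    using that by (auto simp: K_def)
  have "convex K"
  proof (rule convexI)
    fix z z' u v assume z: "z \<in> K" "z' \<in> K" and uv: "(0::real) \<le> u" "0 \<le> v" "u + v = 1"
    obtain Y t Y' t' where z_eq: "z = (L Y - c, t)" "z' = (L Y' - c, t')"
      and psd: "pos_semidefinite Y" "pos_semidefinite Y'"
      and t: "t < B \<bullet> Y - d" "t' < B \<bullet> Y' - d"
      using z by (auto simp: K_def)
    define Z where "Z = u *\<^sub>R Y + v *\<^sub>R Y'"
    have "L Z = u *\<^sub>R L Y + v *\<^sub>R L Y'"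
      by (simp add: L_def Z_def vec_eq_iff inner_add_right)
    moreover have "c = u *\<^sub>R c + v *\<^sub>R c" using uv by (simp flip: scaleR_left_distrib)
    ultimately have "u *\<^sub>R z + v *\<^sub>R z' = (L Z - c, u * t + v * t')"
      by (simp add: z_eq algebra_simps)
    moreover have "u * t + v * t' < B \<bullet> Z - d"
    proof -
      \<comment> \<open>Strictness must come from a positive weight: if \<open>u = 0\<close>, then
        \<open>v = 1\<close>.\<close>
      have "u * t + v * t' < u * (B \<bullet> Y - d) + v * (B \<bullet> Y' - d)"
      proof (cases "u = 0")
        case True then show ?thesis using uv t by simp
      next
        case False then show ?thesis
          using uv t by (intro add_less_le_mono mult_left_mono mult_strict_left_mono) auto
      qed
      also have "\<dots> = B \<bullet> Z - (u + v) * d" by (simp add: Z_def inner_add_right algebra_simps)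
      finally show ?thesis using uv by simp
    qed
    moreover have "pos_semidefinite Z"
      unfolding Z_def using psd uv by (intro pos_semidefinite_add pos_semidefinite_scaleR)
    ultimately show "u *\<^sub>R z + v *\<^sub>R z' \<in> K" using K_I by simp
  qed
  moreover have "K \<noteq> {}"
    using K_I[OF pos_definite_imp_pos_semidefinite[OF Y0_pd], of "B \<bullet> Y0 - d - 1"] by auto
  moreover have "0 \<notin> K"
  proof
    assume "0 \<in> K"
    then obtain Y where Y: "L Y = c" "pos_semidefinite Y" "0 < B \<bullet> Y - d"
      by (auto simp: K_def zero_prod_def)
    then have "Y \<in> dsdp_feasible A c"
      by (auto simp: dsdp_feasible_def loewner_ge_def L_def)
    with d Y(3) show False by fastforce
  qed
  ultimately obtain a where a: "a \<in> span K" "a \<noteq> 0" "\<And>z. z \<in> K \<Longrightarrow> 0 \<le> a \<bullet> z"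
    using separating_hyperplane_set_0_inspan[of K] by metis
  obtain y s where ys: "a = (y, s)" by force
  have sep: "0 \<le> X y \<bullet> Y - y \<bullet> c + s * t" if "pos_semidefinite Y" "t < B \<bullet> Y - d" for Y t
    using a(3)[OF K_I[OF that]] by (simp add: ys X_inner inner_diff_right)
  have "s \<le> 0"
  proof (rule ccontr)
    assume s: "\<not> s \<le> 0"
    \<comment> \<open>Below \<open>- d\<close>, so that \<open>t\<close> is admissible for
      \<open>Y = 0\<close>, and below \<open>(y \<bullet> c) / s\<close>, so that the separating
      expression is negative.\<close>
    define t where "t = min (B \<bullet> 0 - d) ((y \<bullet> c) / s) - 1"
    have "0 \<le> X y \<bullet> 0 - y \<bullet> c + s * t"
      by (rule sep) (auto simp: t_def pos_semidefinite_0)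
    moreover have "s * t < s * ((y \<bullet> c) / s)"
      using s by (intro mult_strict_left_mono) (auto simp: t_def)
    ultimately show False using s by simp
  qed
  moreover have "s \<noteq> 0"
  proof
    assume s: "s = 0"
    have ge: "y \<bullet> c \<le> X y \<bullet> Y" if "pos_semidefinite Y" for Y
      using sep[OF that, of "B \<bullet> Y - d - 1"] s by simp
    obtain e where e: "0 < e" "pos_semidefinite (Y0 - e *\<^sub>R X y)"
      using pos_definite_perturb[OF Y0_pd X_sym] .
    have eq: "X y \<bullet> Y0 = y \<bullet> c" by (simp add: X_inner LY0)
    \<comment> \<open>Moving from \<open>Y0\<close> against \<open>X y\<close> lowers
      \<open>X y \<bullet> Y\<close> below its value \<open>y \<bullet> c\<close> at
      \<open>Y0\<close>, which \<open>ge\<close> forbids unless \<open>X y = 0\<close>.\<close>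
    have "e * (X y \<bullet> X y) \<le> 0"
      using ge[OF e(2)] by (simp add: inner_diff_right eq)
    then have X0: "X y = 0" using e(1) by (metis inner_gt_zero_iff mult_pos_pos not_le)
    \<comment> \<open>Since \<open>c = L Y0\<close>, the functional \<open>a\<close> sees only
      \<open>X y \<bullet> (Y - Y0)\<close>, so it vanishes on \<open>K\<close>; lying in the span
      of \<open>K\<close>, it would be zero.\<close>
    have "orthogonal a z" if z: "z \<in> K" for z
    proof -
      obtain Y t where "z = (L Y - c, t)" using z by (auto simp: K_def)
      then have "a \<bullet> z = X y \<bullet> Y - X y \<bullet> Y0"
        by (simp add: ys s inner_diff_right X_inner LY0)
      then show ?thesis by (simp add: X0 orthogonal_def)
    qed
    then have "orthogonal a a" using a(1) orthogonal_to_span by blast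
    with a(2) show False by (simp add: orthogonal_self)
  qed
  ultimately have s: "s < 0" by simp
  \<comment> \<open>Normalizes the coefficient of \<open>t\<close> to -1.\<close>
  define x where "x = (1 / - s) *\<^sub>R y"
  have key: "x \<bullet> c - d \<le> (X x - B) \<bullet> Y" if Y: "pos_semidefinite Y" for Y
  proof -
    have "B \<bullet> Y - d \<le> X x \<bullet> Y - x \<bullet> c"
    \<comment> \<open>Separation bounds every \<open>t\<close> strictly below
      \<open>B \<bullet> Y - d\<close>; the bound passes to the supremum.\<close>
    proof (rule dense_le)
      fix t assume "t < B \<bullet> Y - d"
      from sep[OF Y this] have "(- s) * t \<le> y \<bullet> L Y - y \<bullet> c" by (simp add: X_inner)
      then show "t \<le> X x \<bullet> Y - x \<bullet> c"
        using s by (simp add: X_inner x_def field_simps)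
    qed
    then show ?thesis by (simp add: inner_diff_left)
  qed
  have "pos_semidefinite (X x - B)"
    using symmetric_matrix_diff[OF X_sym B] key by (rule pos_semidefinite_if_inner_bounded_below)
  then have "x \<in> sdp_feasible A B"
    by (simp add: sdp_feasible_def loewner_ge_def X_def)
  \<comment> \<open>At \<open>Y = 0\<close> the inequality \<open>key\<close> reads
    \<open>x \<bullet> c - d \<le> 0\<close>.\<close>
  moreover have "sdp_objective c x \<le> d"
    using key[OF pos_semidefinite_0] by (simp add: sdp_objective_eq_inner)
  ultimately show ?thesis by (rule that)
qed

theorem theorem4:
  fixes A :: "'n::finite \<Rightarrow> real^'m^'m"
    and B :: "real^'m^'m"
    and c :: "real^'n"
  assumes "\<And>i. symmetric_matrix (A i)"
    and "symmetric_matrix B"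
  shows "(dsdp_bounded A B c \<and> dsdp_strictly_feasible A c \<noteq> {} \<longrightarrow>
            sdp_value A B c = dsdp_value A B c \<and> sdp_attained A B c) \<and>
         (dsdp_unbounded A B c \<longrightarrow> sdp_feasible A B = {})"
proof (intro conjI impI)
  assume asm: "dsdp_bounded A B c \<and> dsdp_strictly_feasible A c \<noteq> {}"
  then obtain Y0 where Y0: "Y0 \<in> dsdp_strictly_feasible A c" by blast
  then have "Y0 \<in> dsdp_feasible A c"
    by (simp add: dsdp_strictly_feasible_def dsdp_feasible_def loewner_gt_def loewner_ge_def
        pos_definite_imp_pos_semidefinite)
  then have "ereal (B \<bullet> Y0) \<le> dsdp_value A B c"
    unfolding dsdp_value_def by (rule SUP_upper)
  \<comment> \<open>The value is finite: \<open>Y0\<close> excludes minus infinity and boundedness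
    excludes plus infinity.\<close>
  then obtain d where d: "dsdp_value A B c = ereal d"
    using asm by (cases "dsdp_value A B c") (auto simp: dsdp_bounded_def)
  have "B \<bullet> Y \<le> d" if "Y \<in> dsdp_feasible A c" for Y
    using SUP_upper[OF that, of "\<lambda>Y. ereal (B \<bullet> Y)"] d by (simp add: dsdp_value_def)
  then obtain x where x: "x \<in> sdp_feasible A B" "sdp_objective c x \<le> d"
    using sdp_feasible_below_dual_bound[OF assms _ Y0] by blast
  have le: "ereal d \<le> sdp_value A B c"
    unfolding sdp_value_def d[symmetric] by (intro INF_greatest dsdp_value_le_sdp_objective)
  have "sdp_value A B c \<le> ereal (sdp_objective c x)"
    unfolding sdp_value_def by (rule INF_lower) (rule x(1))
  also have "\<dots> \<le> ereal d" using x(2) by simp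
  finally have eq: "sdp_value A B c = ereal d" using le by simp
  then show "sdp_value A B c = dsdp_value A B c" by (simp add: d)
  have "sdp_objective c x = d"
    using dsdp_value_le_sdp_objective[OF x(1), of c] x(2) by (simp add: d)
  then show "sdp_attained A B c" using x(1) eq by (auto simp: sdp_attained_def)
next
  assume "dsdp_unbounded A B c"
  \<comment> \<open>By weak duality, a primal feasible point would put a real upper bound on the
    dual value.\<close>
  then show "sdp_feasible A B = {}"
    using dsdp_value_le_sdp_objective[of _ A B c] by (auto simp: dsdp_unbounded_def)
qed

end
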